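(* Let $s,t,a$ be integers with $2\le a\le s\le t$ and $a(s+t-a-2)\ge s+t-1$. Then $$r\!\left(K_{n,n},K_{s,t},\,st-a(s+t-a-2)+1\right)=\Omega\!\left(n^{1/a}\right).$$
   Context: For graphs $G,H$ and an integer $q$ with $2\le q\le |E(H)|$, an $(H,q)$-coloring of $G$ is an edge-coloring of $G$ in which every subgraph of $G$ isomorphic to $H$ receives at least $q$ distinct colors; $r(G,H,q)$ is the minimum number of colors needed for $G$ to have an $(H,q)$-coloring. $K_{n,n}$, $K_{s,t}$ denote complete bipartite graphs. Asymptotic notation refers to $n\to\infty$ with $s,t,a$ fixed. *)

theory Defs
  imports Complex_Main "HOL-Library.Landau_Symbols"
begin

text \<open>An undirected graph is a pair of a vertex set and a set of edges, an edge being the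
  two-element set of its end vertices.\<close>

type_synonym 'a ugraph = "'a set \<times> 'a set set"

abbreviation verts :: "'a ugraph \<Rightarrow> 'a set" where
  "verts G \<equiv> fst G"

abbreviation edges :: "'a ugraph \<Rightarrow> 'a set set" where
  "edges G \<equiv> snd G"

definition simple_graph :: "'a ugraph \<Rightarrow> bool" where
  "simple_graph G \<longleftrightarrow> (\<forall>e\<in>edges G. e \<subseteq> verts G \<and> card e = 2)"

definition subgraph_of :: "'a ugraph \<Rightarrow> 'a ugraph \<Rightarrow> bool" where
  "subgraph_of F G \<longleftrightarrow> simple_graph F \<and> verts F \<subseteq> verts G \<and> edges F \<subseteq> edges G"

definition isomorphic_graphs :: "'a ugraph \<Rightarrow> 'b ugraph \<Rightarrow> bool" where
  "isomorphic_graphs F H \<longleftrightarrow>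
     (\<exists>f. bij_betw f (verts F) (verts H) \<and>
          (\<forall>u\<in>verts F. \<forall>v\<in>verts F. {u, v} \<in> edges F \<longleftrightarrow> {f u, f v} \<in> edges H))"

definition Hq_coloring :: "'a ugraph \<Rightarrow> 'b ugraph \<Rightarrow> nat \<Rightarrow> ('a set \<Rightarrow> 'c) \<Rightarrow> bool" where
  "Hq_coloring G H q c \<longleftrightarrow>
     (\<forall>F. subgraph_of F G \<and> isomorphic_graphs F H \<longrightarrow> q \<le> card (c ` edges F))"

text \<open>The palette of \<open>k\<close> colors is \<open>{..<k}\<close>. For finite simple \<open>G\<close>, \<open>H\<close> with
  \<open>q \<le> card (edges H)\<close> the minimum exists, since coloring all edges of \<open>G\<close> differently
  is an \<open>(H,q)\<close>-coloring.\<close>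

definition ramsey_r :: "'a ugraph \<Rightarrow> 'b ugraph \<Rightarrow> nat \<Rightarrow> nat" where
  "ramsey_r G H q =
     (LEAST k. \<exists>c :: 'a set \<Rightarrow> nat. c ` edges G \<subseteq> {..<k} \<and> Hq_coloring G H q c)"

definition complete_bipartite :: "nat \<Rightarrow> nat \<Rightarrow> (nat + nat) ugraph" where
  "complete_bipartite m n =
     (Inl ` {..<m} \<union> Inr ` {..<n}, {{Inl i, Inr j} | i j. i < m \<and> j < n})"

end

theory Submission
  imports Defs "HOL-Library.FuncSet"
begin

text \<open>With \<open>k\<close> colors there are at most \<open>k\<^sup>a\<close> color patterns from a vertex to \<open>a\<close> fixed vertices
  of the other side. Fix \<open>a\<close> left vertices \<open>A\<close>. If \<open>n\<close> exceeds a constant multiple of \<open>k\<^sup>a\<close>, then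
  some \<open>t\<close> right vertices \<open>T\<close> have the same pattern to \<open>A\<close>; fix \<open>a\<close> of them, \<open>B\<close>, and likewise find
  \<open>s - a\<close> left vertices \<open>S'\<close> outside \<open>A\<close> with the same pattern to \<open>B\<close>. In the copy of
  \<open>K\<^sub>s\<^sub>,\<^sub>t\<close> on \<open>A \<union> S'\<close> and \<open>T\<close>, the edges of \<open>A \<times> T\<close> and of \<open>S' \<times> B\<close> carry at most \<open>a\<close> colors
  each, so there are at most \<open>2a + (s - a)(t - a) = st - a(s + t - a - 2)\<close> colors. Hence a
  coloring as in the theorem needs \<open>k\<^sup>a\<close> to be at least linear in \<open>n\<close>.\<close>

lemma pigeonhole_common_pattern:
  fixes d :: "'a \<Rightarrow> 'b \<Rightarrow> nat"
  assumes "finite X" "finite B" and d: "\<And>x y. x \<in> X \<Longrightarrow> y \<in> B \<Longrightarrow> d x y < k"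
    and card: "m * k ^ card B < card X"
  obtains Y where "Y \<subseteq> X" "card Y = m" "\<And>x x' y. x \<in> Y \<Longrightarrow> x' \<in> Y \<Longrightarrow> y \<in> B \<Longrightarrow> d x y = d x' y"
proof -
  \<comment> \<open>Restriction makes each pattern an extensional function, so all patterns lie in a
    finite set of \<open>k ^ card B\<close> elements.\<close>
  define f where "f x = restrict (d x) B" for x
  define P where "P = B \<rightarrow>\<^sub>E {..<k}"
  have P: "finite P" "card P = k ^ card B"
    using \<open>finite B\<close> by (auto simp: P_def card_PiE intro: finite_PiE)
  have X: "X \<subseteq> (\<Union>p\<in>P. {x \<in> X. f x = p})"
    using d by (auto simp: P_def f_def)
  have "\<exists>p\<in>P. m \<le> card {x \<in> X. f x = p}"
  proof (rule ccontr)
    assume "\<not> ?thesis"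
    then have "(\<Sum>p\<in>P. card {x \<in> X. f x = p}) \<le> (\<Sum>p\<in>P. m)"
      by (intro sum_mono) auto
    moreover have "card X \<le> (\<Sum>p\<in>P. card {x \<in> X. f x = p})"
      using card_mono[OF _ X] card_UN_le[OF P(1), of "\<lambda>p. {x \<in> X. f x = p}"] P(1) \<open>finite X\<close>
      by fastforce
    ultimately show False
      using card P(2) by (simp add: mult.commute)
  qed
  then obtain p where "m \<le> card {x \<in> X. f x = p}" by blast
  then obtain Y where Y: "Y \<subseteq> {x \<in> X. f x = p}" "card Y = m"
    by (meson obtain_subset_with_card_n)
  show thesis
  proof (rule that[OF _ Y(2)])
    show "d x y = d x' y" if "x \<in> Y" "x' \<in> Y" "y \<in> B" for x x' y
    proof -
      have "f x = f x'" using that Y by auto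
      then show ?thesis using \<open>y \<in> B\<close> by (metis f_def restrict_apply')
    qed
  qed (use Y in auto)
qed

lemma rectangle_with_few_colors:
  fixes d :: "nat \<Rightarrow> nat \<Rightarrow> nat"
  assumes "1 \<le> a" "a \<le> s" "s \<le> t" and d: "\<And>i j. i < n \<Longrightarrow> j < n \<Longrightarrow> d i j < k"
    and n: "a + t * k ^ a < n"
  obtains S T where "S \<subseteq> {..<n}" "T \<subseteq> {..<n}" "card S = s" "card T = t"
    "card ((\<lambda>(i, j). d i j) ` (S \<times> T)) \<le> 2 * a + (s - a) * (t - a)"
proof -
  define A where "A = {..<a}"
  have A: "finite A" "card A = a" "A \<subseteq> {..<n}" using n by (auto simp: A_def)
  have "t * k ^ card A < card {..<n}" using A n by simp
  moreover have "d i j < k" if "j \<in> {..<n}" "i \<in> A" for i j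
    using that A d by auto
  ultimately obtain T where T: "T \<subseteq> {..<n}" "card T = t"
      "\<And>j j' i. j \<in> T \<Longrightarrow> j' \<in> T \<Longrightarrow> i \<in> A \<Longrightarrow> d i j = d i j'"
    using pigeonhole_common_pattern[of "{..<n}" A "\<lambda>j i. d i j" k t] A(1)
    by (metis finite_lessThan)
  have fT: "finite T" using T(1) finite_subset by blast
  obtain B where B: "B \<subseteq> T" "card B = a" "finite B"
    using obtain_subset_with_card_n[of a T] T(2) assms by auto
  \<comment> \<open>Since \<open>s - a \<le> t\<close>, the bound on \<open>n\<close> that produced
    \<open>T\<close> also suffices among the \<open>n - a\<close> left vertices outside
    \<open>A\<close>.\<close>
  have "(s - a) * k ^ a \<le> t * k ^ a" using assms by (intro mult_right_mono) auto
  then have "(s - a) * k ^ a < n - a" using n by linarith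
  then have "(s - a) * k ^ card B < card ({..<n} - A)"
    using A B by (simp add: card_Diff_subset)
  moreover have "d i j < k" if "i \<in> {..<n} - A" "j \<in> B" for i j
    using that T B d by auto
  ultimately obtain S' where S': "S' \<subseteq> {..<n} - A" "card S' = s - a"
      "\<And>i i' j. i \<in> S' \<Longrightarrow> i' \<in> S' \<Longrightarrow> j \<in> B \<Longrightarrow> d i j = d i' j"
    using pigeonhole_common_pattern[of "{..<n} - A" B d k "s - a"] B by (metis finite_Diff finite_lessThan)
  have fS: "finite S'" using S'(1) finite_subset by blast
  have cS: "card (A \<union> S') = s"
    using card_Un_disjoint[OF A(1) fS] S' A assms by auto
  obtain j0 where j0: "j0 \<in> T" using T(2) assms by fastforce
  \<comment> \<open>If \<open>s = a\<close>, then \<open>S'\<close> is empty and \<open>i0\<close>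
    is arbitrary; it still adds at most \<open>card B\<close> colors to the set \<open>U\<close>
    below.\<close>
  define i0 where "i0 = (SOME i. i \<in> S')"
  have i0: "i0 \<in> S'" if "i \<in> S'" for i using that unfolding i0_def by (rule someI)
  \<comment> \<open>The common patterns let column \<open>j0\<close> represent all of
    \<open>T\<close> on \<open>A\<close>, and row \<open>i0\<close> all of \<open>S'\<close> on
    \<open>B\<close>. Only \<open>S' \<times> (T - B)\<close> is counted edge by edge.\<close>
  define U where "U = (\<lambda>i. d i j0) ` A \<union> (\<lambda>j. d i0 j) ` B \<union> (\<lambda>(i, j). d i j) ` (S' \<times> (T - B))"
  have "(\<lambda>(i, j). d i j) ` ((A \<union> S') \<times> T) \<subseteq> U"
  proof clarsimp
    fix i j assume ij: "i \<in> A \<or> i \<in> S'" "j \<in> T"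
    consider "i \<in> A" | "i \<in> S'" "j \<in> B" | "i \<in> S'" "j \<in> T - B" using ij by auto
    then show "d i j \<in> U"
    proof cases
      case 1
      then have "d i j = d i j0" using T(3) ij j0 by blast
      with 1 show ?thesis by (auto simp: U_def)
    next
      case 2
      then have "d i j = d i0 j" using S'(3) i0 by blast
      with 2 show ?thesis by (auto simp: U_def)
    qed (force simp: U_def)
  qed
  moreover have "finite U" using A B fS fT by (auto simp: U_def)
  ultimately have "card ((\<lambda>(i, j). d i j) ` ((A \<union> S') \<times> T)) \<le> card U"
    by (rule card_mono[rotated])
  also have "\<dots> \<le> card A + card B + card (S' \<times> (T - B))"
    unfolding U_def
    by (intro order.trans[OF card_Un_le] add_mono card_image_le A B finite_cartesian_product fS finite_Diff fT)
  also have "\<dots> = 2 * a + (s - a) * (t - a)"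
    using A B T S' by (simp add: card_cartesian_product card_Diff_subset)
  finally show thesis
    using that[of "A \<union> S'" T] A S' T cS by auto
qed

text \<open>Arbitrary sides let one notion cover the host graph, the pattern and its copies. With
  the edges as an image of \<open>S \<times> T\<close>, their colors are those of a
  rectangle.\<close>

definition biclique :: "'a set \<Rightarrow> 'b set \<Rightarrow> ('a + 'b) ugraph" where
  "biclique S T = (Inl ` S \<union> Inr ` T, (\<lambda>(i, j). {Inl i, Inr j}) ` (S \<times> T))"

lemma complete_bipartite_eq_biclique: "complete_bipartite m n = biclique {..<m} {..<n}"
  by (auto simp: complete_bipartite_def biclique_def)

lemma biclique_subgraph:
  assumes "S \<subseteq> S'" "T \<subseteq> T'"
  shows "subgraph_of (biclique S T) (biclique S' T')"
  using assms by (auto simp: subgraph_of_def simple_graph_def biclique_def)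

lemma biclique_isomorphic:
  assumes g: "bij_betw g S S'" and h: "bij_betw h T T'"
  shows "isomorphic_graphs (biclique S T) (biclique S' T')"
proof -
  \<comment> \<open>The fresh type variables make this usable for both graphs, whose vertex types
    may differ.\<close>
  have edge: "{u, v} \<in> edges (biclique S T) \<longleftrightarrow>
      (\<exists>i\<in>S. \<exists>j\<in>T. u = Inl i \<and> v = Inr j \<or> u = Inr j \<and> v = Inl i)"
    for u v and S :: "'x set" and T :: "'y set"
    by (auto simp: biclique_def doubleton_eq_iff)
  have "bij_betw (map_sum g h) (verts (biclique S T)) (verts (biclique S' T'))"
    using g h by (force simp: bij_betw_def biclique_def inj_on_def image_Un image_image)
  moreover have "{u, v} \<in> edges (biclique S T) \<longleftrightarrow>
      {map_sum g h u, map_sum g h v} \<in> edges (biclique S' T')"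
    if "u \<in> verts (biclique S T)" "v \<in> verts (biclique S T)" for u v
    using that bij_betwE[OF g] bij_betwE[OF h] unfolding edge
    by (auto simp: biclique_def)
  ultimately show ?thesis
    unfolding isomorphic_graphs_def by blast
qed

lemma card_edges_biclique: "card (edges (biclique S T)) = card S * card T"
proof -
  have "inj_on (\<lambda>(i, j). {Inl i, Inr j} :: ('a + 'b) set) (S \<times> T)"
    by (auto simp: inj_on_def doubleton_eq_iff)
  then show ?thesis
    by (simp add: biclique_def card_image card_cartesian_product)
qed

text \<open>Every edge of \<open>H\<close> has two end vertices in \<open>H\<close>, so it pulls
  back along the bijection to an edge of \<open>F\<close>.\<close>

lemma isomorphic_graphs_card_edges_le:
  assumes "isomorphic_graphs F H" "simple_graph H" "finite (edges F)"
  shows "card (edges H) \<le> card (edges F)"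
proof -
  obtain f where f: "bij_betw f (verts F) (verts H)"
    "\<And>u v. u \<in> verts F \<Longrightarrow> v \<in> verts F \<Longrightarrow> {u, v} \<in> edges F \<longleftrightarrow> {f u, f v} \<in> edges H"
    using assms(1) by (auto simp: isomorphic_graphs_def)
  have "edges H \<subseteq> image f ` edges F"
  proof
    fix e assume e: "e \<in> edges H"
    then obtain x y where xy: "e = {x, y}" "x \<in> verts H" "y \<in> verts H"
      using assms(2) by (fastforce simp: simple_graph_def card_2_iff)
    then obtain u v where "u \<in> verts F" "v \<in> verts F" "x = f u" "y = f v"
      using f(1) by (metis bij_betw_imp_surj_on imageE)
    with f(2) e xy have "{u, v} \<in> edges F" "e = f ` {u, v}" by auto
    then show "e \<in> image f ` edges F" by blast
  qed
  then show ?thesis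
    using assms(3) by (rule surj_card_le[rotated])
qed

text \<open>The \<open>LEAST\<close> in \<open>ramsey_r\<close> is attained once some palette works.
  An injective coloring of the edges is a witness, because a copy of \<open>H\<close> then shows at
  least \<open>card (edges H)\<close> colors.\<close>

lemma ramsey_r_coloring:
  fixes G :: "'a ugraph" and H :: "'b ugraph"
  assumes "finite (edges G)" "simple_graph H" "q \<le> card (edges H)"
  obtains c :: "'a set \<Rightarrow> nat"
  where "c ` edges G \<subseteq> {..<ramsey_r G H q}" "Hq_coloring G H q c"
proof -
  obtain c :: "'a set \<Rightarrow> nat" where c: "inj_on c (edges G)" "c ` edges G = {..<card (edges G)}"
    using ex_bij_betw_finite_nat[OF assms(1)] by (auto simp: bij_betw_def lessThan_atLeast0)
  have "Hq_coloring G H q c"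
    unfolding Hq_coloring_def
  proof (intro allI impI)
    fix F assume F: "subgraph_of F G \<and> isomorphic_graphs F H"
    then have sub: "edges F \<subseteq> edges G" by (simp add: subgraph_of_def)
    then have "card (c ` edges F) = card (edges F)"
      using c(1) by (meson card_image inj_on_subset)
    moreover have "card (edges H) \<le> card (edges F)"
      using F assms sub by (meson isomorphic_graphs_card_edges_le finite_subset)
    ultimately show "q \<le> card (c ` edges F)" using assms(3) by linarith
  qed
  with c(2) have "\<exists>k. \<exists>c :: 'a set \<Rightarrow> nat. c ` edges G \<subseteq> {..<k} \<and> Hq_coloring G H q c"
    by blast
  from LeastI_ex[OF this] show thesis
    using that unfolding ramsey_r_def by blast
qed

lemma ramsey_r_bipartite_power_bound:
  assumes "1 \<le> a" "a \<le> s" "s \<le> t" and q: "2 * a + (s - a) * (t - a) < q" "q \<le> s * t"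
  shows "n \<le> a + t * ramsey_r (complete_bipartite n n) (complete_bipartite s t) q ^ a"
proof (rule ccontr)
  define G where "G = biclique {..<n} {..<n}"
  define H where "H = biclique {..<s} {..<t}"
  define k where "k = ramsey_r G H q"
  assume "\<not> ?thesis"
  then have n: "a + t * k ^ a < n"
    by (simp add: complete_bipartite_eq_biclique k_def G_def H_def)
  have "finite (edges G)" "simple_graph H" "q \<le> card (edges H)"
    using q by (auto simp: G_def H_def card_edges_biclique) (auto simp: biclique_def simple_graph_def)
  then obtain c :: "(nat + nat) set \<Rightarrow> nat"
    where c: "c ` edges G \<subseteq> {..<k}" "Hq_coloring G H q c"
    unfolding k_def by (rule ramsey_r_coloring)
  have "c {Inl i, Inr j} < k" if "i < n" "j < n" for i j
    using that c(1) by (force simp: G_def biclique_def)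
  then obtain S T where ST: "S \<subseteq> {..<n}" "T \<subseteq> {..<n}" "card S = s" "card T = t"
    "card ((\<lambda>(i, j). c {Inl i, Inr j}) ` (S \<times> T)) \<le> 2 * a + (s - a) * (t - a)"
    using rectangle_with_few_colors[of a s t n "\<lambda>i j. c {Inl i, Inr j}" k] assms n by blast
  have fin: "finite S" "finite T" using ST finite_subset by blast+
  obtain g h where "bij_betw g S {..<s}" "bij_betw h T {..<t}"
    using ex_bij_betw_finite_nat[OF fin(1)] ex_bij_betw_finite_nat[OF fin(2)] ST
    by (auto simp: lessThan_atLeast0)
  then have "isomorphic_graphs (biclique S T) H"
    unfolding H_def by (rule biclique_isomorphic)
  moreover have "subgraph_of (biclique S T) G"
    unfolding G_def using ST by (intro biclique_subgraph)
  ultimately have "q \<le> card (c ` edges (biclique S T))"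
    using c(2) unfolding Hq_coloring_def by blast
  also have "c ` edges (biclique S T) = (\<lambda>(i, j). c {Inl i, Inr j}) ` (S \<times> T)"
    by (simp add: biclique_def image_image case_prod_unfold)
  finally show False using ST q by simp
qed

text \<open>For \<open>n > b\<close> the value \<open>r n\<close> is positive, so \<open>b\<close>
  is absorbed into a multiple of \<open>r n ^ a\<close>; then \<open>a\<close>-th roots are
  taken.\<close>

lemma bigomega_root_if_power_bound:
  fixes r :: "nat \<Rightarrow> nat"
  assumes "1 \<le> a" and bound: "\<And>n. n \<le> b + m * r n ^ a"
  shows "(\<lambda>n. real (r n)) \<in> \<Omega>(\<lambda>n. real n powr (1 / real a))"
proof -
  \<comment> \<open>The summand 1 keeps \<open>C\<close> positive even if
    \<open>b = m = 0\<close>.\<close>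
  define C where "C = real (b + m + 1)"
  have C: "C > 0" by (simp add: C_def)
  have "C powr (- 1 / real a) * real n powr (1 / real a) \<le> real (r n)" if "n > b" for n
  proof -
    have r: "r n > 0"
      using bound[of n] that \<open>1 \<le> a\<close> by (cases "r n = 0") (auto simp: power_0_left)
    then have "1 \<le> r n ^ a" by simp
    then have "b * 1 \<le> b * r n ^ a" by (rule mult_le_mono2)
    then have "n \<le> b * r n ^ a + m * r n ^ a"
      using bound[of n] by linarith
    then have "n \<le> (b + m + 1) * r n ^ a"
      by (simp add: algebra_simps)
    then have "real n \<le> C * real (r n) ^ a"
      unfolding C_def by (metis of_nat_le_iff of_nat_mult of_nat_power)
    then have "real n / C \<le> real (r n) ^ a"
      using C by (simp add: field_simps)
    then have "(real n / C) powr (1 / real a) \<le> (real (r n) ^ a) powr (1 / real a)"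
      using C by (intro powr_mono2) auto
    also have "\<dots> = real (r n)"
      using r \<open>1 \<le> a\<close> by (simp add: powr_realpow[symmetric] powr_powr)
    finally show ?thesis
      using C by (simp add: powr_divide powr_minus divide_simps)
  qed
  then show ?thesis
    using C by (intro landau_omega.bigI[of "C powr (- 1 / real a)"])
      (auto intro!: eventually_mono[OF eventually_gt_at_top[of b]])
qed

theorem theorem1p13:
  fixes s t a :: nat
  assumes "2 \<le> a" and "a \<le> s" and "s \<le> t"
    and "a * (s + t - a - 2) \<ge> s + t - 1"
  shows "(\<lambda>n. real (ramsey_r (complete_bipartite n n) (complete_bipartite s t)
            (s * t - a * (s + t - a - 2) + 1)))
         \<in> \<Omega>(\<lambda>n. real n powr (1 / real a))"
proof -
  \<comment> \<open>These substitutions turn the truncated subtractions into exact ones: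
    \<open>s + t - a - 2\<close> becomes \<open>w + u + v\<close>.\<close>
  obtain u v where uv: "s = a + u" "t = a + v"
    using assms le_Suc_ex by (metis le_trans)
  obtain w where w: "a = w + 2" using assms(1) by (metis add.commute le_Suc_ex)
  have eq: "s * t = a * (s + t - a - 2) + (2 * a + (s - a) * (t - a))"
    unfolding uv by (simp add: w algebra_simps)
  \<comment> \<open>This keeps the number of required colors at most \<open>s * t\<close>, so that a
    coloring exists. By \<open>eq\<close> it exceeds the rectangle bound by exactly one.\<close>
  have "a * (s + t - a - 2) \<ge> 1" using assms by linarith
  then show ?thesis
    using assms eq
    by (intro bigomega_root_if_power_bound[of a a t] ramsey_r_bipartite_power_bound) auto
qed

end
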